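(* Every integer $k\ge 8$ that is a multiple of $8$ satisfies $g\left(n,k,\frac{9k^2}{32}-\frac{9k}{8}+5\right)=\Omega(n^{4/3})$ as $n\to\infty$, where the implied constant may depend on $k$.
   Context: For a finite set $A\subset\mathbb{R}$, define its (positive) difference set $A-A=\{a-a' : a,a'\in A,\ a-a'>0\}$. For positive integers $n,k$ and a real $\ell$, let $g(n,k,\ell)$ be the minimum of $|A-A|$ over all sets $A$ of $n$ real numbers such that every subset $A'\subset A$ with $|A'|=k$ satisfies $|A'-A'|\ge \ell$. *)

theory Defs
  imports Complex_Main "HOL-Library.Landau_Symbols"
begin

definition pos_diffs :: "real set \<Rightarrow> real set" where
  "pos_diffs A = {a - a' | a a'. a \<in> A \<and> a' \<in> A \<and> a - a' > 0}"

definition local_diff_property :: "nat \<Rightarrow> real \<Rightarrow> real set \<Rightarrow> bool" where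
  "local_diff_property k l A \<longleftrightarrow>
     (\<forall>A'. A' \<subseteq> A \<and> card A' = k \<longrightarrow> real (card (pos_diffs A')) \<ge> l)"

text \<open>
  On \<^typ>\<open>nat\<close>, \<^const>\<open>Inf\<close> of a nonempty set is its minimum. It is 0 for the empty set, which
  arises only if no set of \<open>n\<close> reals has the local property; a lower bound on
  \<open>g_diff\<close> is therefore never obtained vacuously.
\<close>
definition g_diff :: "nat \<Rightarrow> nat \<Rightarrow> real \<Rightarrow> nat" where
  "g_diff n k l =
     Inf {card (pos_diffs A) | A. finite A \<and> card A = n \<and> local_diff_property k l A}"

end

theory Submission
  imports Defs
begin

text \<open>
  Suppose that \<open>A\<close> has \<open>n\<close> elements and fewer than \<open>c n\<^bsup>4/3\<^esup>\<close> differences. A popular difference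
  \<open>t\<close> gives a set \<open>B\<close> of more than \<open>n\<^bsup>2/3\<^esup> / (4c)\<close> elements with \<open>B \<union> (B + t) \<subseteq> A\<close>. All differences
  of \<open>B\<close> are differences of \<open>A\<close>, so a second pigeonhole step inside \<open>B\<close> gives \<open>s \<noteq> t\<close> and a
  number of translates of \<open>{0, s, t, s + t}\<close> in \<open>A\<close> that is at least a constant as large as we
  like, for small \<open>c\<close>. Among them there are \<open>m = k/4\<close> pairwise disjoint ones. Two translates
  contribute at most 9 differences between them, so these \<open>k\<close> points span at most
  \<open>9 m (m - 1) / 2 + 4 = 9 k\<^sup>2/32 - 9 k/8 + 4\<close> differences, one too few for the local property.
  The local property itself is satisfiable: the powers of 3 have pairwise distinct differences.
\<close>

section \<open>Counting pairs and popular differences\<close>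

lemma card_less_pairs:
  fixes B :: "'a::linorder set"
  assumes "finite B"
  shows "2 * card {(x, y). x \<in> B \<and> y \<in> B \<and> x < y} = card B * (card B - 1)"
  using assms
proof (induction B rule: finite_linorder_max_induct)
  case empty
  show ?case by simp
next
  case (insert b B)
  let ?P = "{(x, y). x \<in> B \<and> y \<in> B \<and> x < y}"
  have "{(x, y). x \<in> insert b B \<and> y \<in> insert b B \<and> x < y} = ?P \<union> B \<times> {b}"
    using insert.hyps by auto
  moreover have "finite ?P"
    by (rule finite_subset[of _ "B \<times> B"]) (use insert.hyps in auto)
  moreover have "?P \<inter> B \<times> {b} = {}"
    using insert.hyps by auto
  ultimately have "card {(x, y). x \<in> insert b B \<and> y \<in> insert b B \<and> x < y} = card ?P + card B"
    using insert.hyps by (simp add: card_Un_disjoint)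
  moreover have "b \<notin> B"
    using insert.hyps by auto
  ultimately show ?case
    using insert by (cases "card B") auto
qed

lemma pos_diffs_eq_image:
  "pos_diffs A = (\<lambda>(x, y). y - x) ` {(x, y). x \<in> A \<and> y \<in> A \<and> x < y}"
  by (force simp: pos_diffs_def)

lemma finite_pos_diffs: "finite A \<Longrightarrow> finite (pos_diffs A)"
  unfolding pos_diffs_eq_image
  by (rule finite_imageI, rule finite_subset[of _ "A \<times> A"]) auto

text \<open>Pigeonhole: the increasing pairs of \<open>B\<close> whose difference is not
  \<open>t\<close> are distributed over at most \<open>card (pos_diffs A)\<close> differences.
  Excluding \<open>t\<close> keeps the parallelogram with sides \<open>s\<close> and
  \<open>t\<close> from degenerating when the step is iterated.\<close>

lemma exists_popular_difference:
  fixes A B :: "real set" and t :: real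
  assumes "finite A" and "B \<subseteq> A" and "card B > 3"
  obtains s where "s > 0" and "s \<noteq> t"
    and "card B * (card B - 3) \<le> 2 * card {x \<in> B. x + s \<in> B} * card (pos_diffs A)"
proof -
  define P where "P = {(x, y). x \<in> B \<and> y \<in> B \<and> x < y}"
  define P' where "P' = {(x, y). x \<in> B \<and> y \<in> B \<and> x < y \<and> y - x \<noteq> t}"
  define D where "D = pos_diffs A"
  define fib where "fib s = {x \<in> B. x + s \<in> B}" for s
  have finB: "finite B"
    using assms finite_subset by blast
  have finP': "finite P'"
    unfolding P'_def by (rule finite_subset[of _ "B \<times> B"]) (use finB in auto)
  \<comment> \<open>A pair with difference \<open>t\<close> is determined by its smaller element, so
    at most \<open>card B\<close> pairs are lost; after doubling, this turns the factor
    \<open>card B - 1\<close> into \<open>card B - 3\<close>.\<close>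
  have "P \<subseteq> P' \<union> (\<lambda>x. (x, x + t)) ` B"
    by (auto simp: P_def P'_def image_iff)
  then have "card P \<le> card (P' \<union> (\<lambda>x. (x, x + t)) ` B)"
    by (intro card_mono) (use finP' finB in auto)
  also have "\<dots> \<le> card P' + card B"
    by (meson card_Un_le card_image_le finB le_trans add_left_mono)
  finally have "card B * (card B - 1) \<le> 2 * card P' + 2 * card B"
    using card_less_pairs[OF finB] by (simp add: P_def)
  then have P'_ge: "card B * (card B - 3) \<le> 2 * card P'"
    by (simp add: diff_mult_distrib2)
  have "card P' > 0"
    using P'_ge assms(3) by (cases "card P'") auto
  then have "P' \<noteq> {}" by auto
  have sub: "(\<lambda>(x, y). y - x) ` P' \<subseteq> D"
    using assms(2) by (fastforce simp: P'_def D_def pos_diffs_def)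
  define I where "I = (\<lambda>(x, y). y - x) ` P'"
  have finD: "finite D"
    unfolding D_def using assms(1) by (rule finite_pos_diffs)
  have finI: "finite I" and "I \<noteq> {}"
    using finP' \<open>P' \<noteq> {}\<close> by (auto simp: I_def)
  obtain s where s: "s \<in> I" and smax: "\<And>r. r \<in> I \<Longrightarrow> card (fib r) \<le> card (fib s)"
  proof -
    have "Max ((\<lambda>r. card (fib r)) ` I) \<in> (\<lambda>r. card (fib r)) ` I"
      using finI \<open>I \<noteq> {}\<close> by (intro Max_in) auto
    then obtain s where "s \<in> I" "Max ((\<lambda>r. card (fib r)) ` I) = card (fib s)" by auto
    then show thesis
      using that finI by (metis Max_ge finite_imageI imageI)
  qed
  have "P' \<subseteq> (\<Union>r\<in>I. (\<lambda>x. (x, x + r)) ` fib r)"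
    by (force simp: P'_def I_def fib_def)
  moreover have finfib: "finite (fib r)" for r
    using finB by (simp add: fib_def)
  ultimately have "card P' \<le> card (\<Union>r\<in>I. (\<lambda>x. (x, x + r)) ` fib r)"
    by (intro card_mono) (use finI in auto)
  also have "\<dots> \<le> (\<Sum>r\<in>I. card ((\<lambda>x. (x, x + r)) ` fib r))"
    by (rule card_UN_le[OF finI])
  also have "\<dots> \<le> (\<Sum>r\<in>I. card (fib s))"
    by (intro sum_mono) (meson card_image_le finfib le_trans smax)
  also have "\<dots> = card I * card (fib s)" by simp
  also have "\<dots> \<le> card D * card (fib s)"
    using sub finD by (intro mult_le_mono1 card_mono) (auto simp: I_def)
  finally have "card B * (card B - 3) \<le> 2 * card (fib s) * card D"
    using P'_ge by (simp add: mult.commute)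
  moreover have "s > 0" "s \<noteq> t"
    using s by (auto simp: I_def P'_def)
  ultimately show thesis
    using that by (simp add: fib_def D_def)
qed

section \<open>Disjoint translates of a parallelogram\<close>

text \<open>Greedy choice: picking \<open>x\<close> and discarding \<open>x + F\<close> costs at
  most \<open>card F\<close> points. Symmetry of \<open>F\<close> makes the separation from later
  points work in both orders.\<close>

lemma exists_separated_subset:
  fixes X F :: "'a::ab_group_add set"
  assumes "finite F" and "0 \<in> F" and "\<And>f. f \<in> F \<Longrightarrow> - f \<in> F"
    and "finite X" and "m * card F \<le> card X"
  shows "\<exists>Y \<subseteq> X. card Y = m \<and> (\<forall>x\<in>Y. \<forall>y\<in>Y. x - y \<in> F \<longrightarrow> x = y)"
  using assms(4,5)
proof (induction m arbitrary: X)
  case 0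
  show ?case by (intro exI[of _ "{}"]) auto
next
  case (Suc m)
  have "card F > 0"
    using assms(1,2) by (auto simp: card_gt_0_iff)
  then have "card X > 0"
    using Suc.prems by auto
  then obtain x where x: "x \<in> X"
    by (metis card_gt_0_iff ex_in_conv)
  define X' where "X' = X - (\<lambda>f. x + f) ` F"
  have "card X - card ((\<lambda>f. x + f) ` F) \<le> card X'"
    unfolding X'_def using assms(1) by (intro diff_card_le_card_Diff) auto
  moreover have "card ((\<lambda>f. x + f) ` F) \<le> card F"
    using assms(1) by (rule card_image_le)
  ultimately have "m * card F \<le> card X'"
    using Suc.prems by simp
  moreover have "finite X'"
    using Suc.prems by (simp add: X'_def)
  ultimately obtain Y where Y: "Y \<subseteq> X'" "card Y = m"
      "\<forall>x\<in>Y. \<forall>y\<in>Y. x - y \<in> F \<longrightarrow> x = y"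
    using Suc.IH by blast
  have far: "y - x \<notin> F" if "y \<in> Y" for y
  proof
    assume "y - x \<in> F"
    then have "x + (y - x) \<in> (\<lambda>f. x + f) ` F" by blast
    then show False
      using that Y(1) by (auto simp: X'_def)
  qed
  have far': "x - y \<notin> F" if "y \<in> Y" for y
    using assms(3)[of "x - y"] far[OF that] by auto
  have "x \<notin> Y"
    using far[of x] assms(2) by auto
  moreover have "finite Y"
    using Y(1) \<open>finite X'\<close> finite_subset by blast
  ultimately have "card (insert x Y) = Suc m"
    using Y(2) by simp
  moreover have "insert x Y \<subseteq> X"
    using x Y(1) by (auto simp: X'_def)
  ultimately show ?case
    using Y(3) far far' by (intro exI[of _ "insert x Y"]) auto
qed

text \<open>Each unordered pair of distinct base points yields at most 9 differences, and those
  inside a single translate are the same at most 4 for all translates.\<close>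

lemma few_differences_from_parallelograms:
  fixes A :: "real set" and s t :: real and m :: nat
  assumes "finite A" and "s > 0" and "t > 0" and "s \<noteq> t"
    and "9 * m \<le> card {x \<in> A. x + s \<in> A \<and> x + t \<in> A \<and> x + s + t \<in> A}"
  shows "\<exists>A' \<subseteq> A. card A' = 4 * m \<and> 2 * card (pos_diffs A') \<le> 9 * (m * (m - 1)) + 8"
proof -
  define X where "X = {x \<in> A. x + s \<in> A \<and> x + t \<in> A \<and> x + s + t \<in> A}"
  define Q where "Q = {0, s, t, s + t}"
  \<comment> \<open>\<open>F\<close> is \<open>Q - Q\<close>, so base points separated by
    \<open>F\<close> have disjoint translates of \<open>Q\<close>.\<close>
  define F where "F = {0, s, t, s + t, - s, - t, - (s + t), s - t, t - s}"
  have QF: "q - q' \<in> F" if "q \<in> Q" "q' \<in> Q" for q q'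
    using that by (auto simp: Q_def F_def)
  have "card F \<le> 9"
    using card_length[of "[0, s, t, s + t, - s, - t, - (s + t), s - t, t - s]"]
    by (simp add: F_def)
  then have "m * card F \<le> m * 9"
    by (rule mult_le_mono2)
  then have "m * card F \<le> card X"
    using assms(5) unfolding X_def by linarith
  moreover have "finite F" "0 \<in> F" "\<And>f. f \<in> F \<Longrightarrow> - f \<in> F"
    by (auto simp: F_def)
  moreover have "finite X"
    using assms(1) by (simp add: X_def)
  ultimately obtain Y where Y: "Y \<subseteq> X" "card Y = m"
      "\<And>x y. x \<in> Y \<Longrightarrow> y \<in> Y \<Longrightarrow> x - y \<in> F \<Longrightarrow> x = y"
    using exists_separated_subset[of F X m] by metis
  have finY: "finite Y"
    using Y(1) \<open>finite X\<close> finite_subset by blast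
  define A' where "A' = (\<lambda>(y, q). y + q) ` (Y \<times> Q)"
  have "inj_on (\<lambda>(y, q). y + q) (Y \<times> Q)"
  proof (rule inj_onI, clarsimp)
    fix y q y' q'
    assume *: "y \<in> Y" "q \<in> Q" "y' \<in> Y" "q' \<in> Q" "y + q = y' + q'"
    then have "y - y' = q' - q" by simp
    then have "y = y'"
      using Y(3) QF * by metis
    then show "y = y' \<and> q = q'"
      using * by simp
  qed
  then have "card A' = card (Y \<times> Q)"
    unfolding A'_def by (rule card_image)
  also have "card Q = 4"
    using assms(2-4) by (simp add: Q_def card_insert_if)
  then have "card (Y \<times> Q) = 4 * m"
    using Y(2) by (simp add: card_cartesian_product)
  finally have cardA': "card A' = 4 * m" .
  have subA: "A' \<subseteq> A"
    using Y(1) by (auto simp: A'_def Q_def X_def add.assoc)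
  define P where "P = {(x, y). x \<in> Y \<and> y \<in> Y \<and> x < y}"
  have finP: "finite P"
    unfolding P_def by (rule finite_subset[of _ "Y \<times> Y"]) (use finY in auto)
  \<comment> \<open>The absolute value covers translates that interleave, where the larger base
    point may carry the smaller element; each pair and each \<open>f\<close> still give only one
    difference.\<close>
  define G where "G = (\<lambda>((x, y), f). \<bar>y - x + f\<bar>) ` (P \<times> F)"
  define H where "H = {s, t, s + t, \<bar>s - t\<bar>}"
  have "pos_diffs A' \<subseteq> H \<union> G"
  proof
    fix d assume "d \<in> pos_diffs A'"
    then obtain y q y' q' where d: "d = (y + q) - (y' + q')" "d > 0"
      and in_sets: "y \<in> Y" "q \<in> Q" "y' \<in> Y" "q' \<in> Q"
      by (auto simp: pos_diffs_def A'_def)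
    consider "y = y'" | "y' < y" | "y < y'" by linarith
    then show "d \<in> H \<union> G"
    proof cases
      case 1
      then show ?thesis
        using d in_sets(2,4) assms(2,3) by (auto simp: Q_def H_def)
    next
      case 2
      then have "((y', y), q - q') \<in> P \<times> F"
        using in_sets QF by (auto simp: P_def)
      moreover have "d = \<bar>y - y' + (q - q')\<bar>"
        using d by linarith
      ultimately show ?thesis
        by (force simp: G_def)
    next
      case 3
      then have "((y, y'), q' - q) \<in> P \<times> F"
        using in_sets QF by (auto simp: P_def)
      moreover have "d = \<bar>y' - y + (q' - q)\<bar>"
        using d by linarith
      ultimately show ?thesis
        by (force simp: G_def)
    qed
  qed
  then have "card (pos_diffs A') \<le> card (H \<union> G)"
    by (intro card_mono) (use finP \<open>finite F\<close> in \<open>auto simp: G_def H_def\<close>)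
  also have "\<dots> \<le> card H + card G"
    by (rule card_Un_le)
  also have "card H \<le> 4"
    by (simp add: H_def card_insert_if)
  also have "card G \<le> card P * card F"
    unfolding G_def card_cartesian_product[symmetric]
    using finP \<open>finite F\<close> by (intro card_image_le) auto
  also have "\<dots> \<le> card P * 9"
    using \<open>card F \<le> 9\<close> by (rule mult_le_mono2)
  finally have "2 * card (pos_diffs A') \<le> 9 * (2 * card P) + 8"
    by simp
  then have "2 * card (pos_diffs A') \<le> 9 * (m * (m - 1)) + 8"
    using card_less_pairs[OF finY] Y(2) by (simp add: P_def)
  then show ?thesis
    using subA cardA' by blast
qed

section \<open>Powers of 3 have distinct differences\<close>

text \<open>The top exponent dominates: the right side is at least \<open>2 * 3 ^ (j - 1)\<close>,
  while the left is below \<open>3 ^ (j - 1)\<close>.\<close>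

lemma power3_diff_less:
  fixes i j a b :: nat
  assumes "i < j" and "b < j"
  shows "(3::real) ^ b - 3 ^ a < 3 ^ j - 3 ^ i"
proof -
  obtain j' where j': "j = Suc j'"
    using assms by (cases j) auto
  have "(3::real) ^ i \<le> 3 ^ j'" "(3::real) ^ b \<le> 3 ^ j'"
    using assms j' by (auto intro: power_increasing)
  moreover have "(0::real) < 3 ^ a" "(0::real) < 3 ^ j'" "(3::real) ^ j = 3 * 3 ^ j'"
    using j' by auto
  ultimately show ?thesis by linarith
qed

lemma power3_diff_inj:
  fixes i j a b :: nat
  assumes "i < j" and "a < b" and "(3::real) ^ j - 3 ^ i = 3 ^ b - 3 ^ a"
  shows "j = b \<and> i = a"
proof -
  have "j = b"
    using power3_diff_less[of i j b a] power3_diff_less[of a b j i] assms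
    by (metis less_irrefl linorder_neqE_nat)
  then show ?thesis
    using assms by simp
qed

lemma card_pos_diffs_powers3:
  assumes "A \<subseteq> range (\<lambda>i. 3 ^ i)" and "finite A"
  shows "2 * card (pos_diffs A) = card A * (card A - 1)"
proof -
  have "inj_on (\<lambda>(x, y). y - x) {(x, y). x \<in> A \<and> y \<in> A \<and> x < y}"
  proof (rule inj_onI)
    fix p p'
    assume p: "p \<in> {(x, y). x \<in> A \<and> y \<in> A \<and> x < y}" "p' \<in> {(x, y). x \<in> A \<and> y \<in> A \<and> x < y}"
      "(\<lambda>(x, y). y - x) p = (\<lambda>(x, y). y - x) p'"
    obtain x y x' y' where pp: "p = (x, y)" "p' = (x', y')"
      by fastforce
    have *: "x \<in> A" "y \<in> A" "x < y" "x' \<in> A" "y' \<in> A" "x' < y'" "y - x = y' - x'"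
      using p by (simp_all add: pp)
    then obtain i j a b where eqs: "x = 3 ^ i" "y = 3 ^ j" "x' = 3 ^ a" "y' = 3 ^ b"
      using assms(1) by (metis rangeE subsetD)
    have "i < j" "a < b"
      using * by (simp_all add: eqs)
    then show "p = p'"
      using power3_diff_inj[of i j a b] *(7) by (simp add: pp eqs)
  qed
  then have "card (pos_diffs A) = card {(x, y). x \<in> A \<and> y \<in> A \<and> x < y}"
    unfolding pos_diffs_eq_image by (rule card_image)
  then show ?thesis
    using card_less_pairs[OF assms(2)] by simp
qed

text \<open>This rules out the default value 0 of \<open>Inf\<close> in \<open>g_diff\<close>. The
  bound on \<open>l\<close> is the number of pairs among \<open>k\<close> points, which powers of 3
  attain.\<close>

lemma exists_local_diff_property:
  fixes l :: real
  assumes "l \<le> real k * (real k - 1) / 2" and "k \<ge> 1"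
  shows "\<exists>A. finite A \<and> card A = n \<and> local_diff_property k l A"
proof (intro exI conjI)
  let ?A = "(\<lambda>i. (3::real) ^ i) ` {..<n}"
  show "finite ?A" by simp
  show "card ?A = n"
    by (subst card_image) (auto simp: inj_on_def)
  show "local_diff_property k l ?A"
    unfolding local_diff_property_def
  proof (intro allI impI, elim conjE)
    fix A' assume A': "A' \<subseteq> ?A" "card A' = k"
    then have "2 * card (pos_diffs A') = k * (k - 1)"
      using card_pos_diffs_powers3[of A'] finite_subset[of A' ?A] by auto
    then have "2 * real (card (pos_diffs A')) = real k * (real k - 1)"
      using assms(2) by (metis of_nat_1 of_nat_diff of_nat_mult of_nat_numeral)
    then show "l \<le> real (card (pos_diffs A'))"
      using assms(1) by simp
  qed
qed

section \<open>The lower bound for a single set\<close>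

text \<open>The constant is \<open>36 * m = 4 * (9 * m)\<close>: \<open>9 * m\<close> base points
  suffice for \<open>m\<close> disjoint parallelograms, and each pigeonhole step reads
  \<open>x^2 \<le> 4 * y * D\<close>.\<close>

lemma card_pos_diffs_lower_bound:
  fixes A :: "real set" and m n :: nat and l :: real
  assumes "finite A" and "card A = n" and "n \<ge> 6" and "m \<ge> 1"
    and local: "local_diff_property (4 * m) l A"
    and l: "l > 9 * real m * (real m - 1) / 2 + 4"
  shows "real (card (pos_diffs A)) \<ge> 1 / (36 * real m) * real n powr (4/3)"
proof (rule ccontr)
  define D where "D = real (card (pos_diffs A))"
  define q where "q = real n powr (2/3)"
  assume "\<not> ?thesis"
  moreover have q2: "real n powr (4/3) = q\<^sup>2"
    using assms(3) by (simp add: q_def powr_power)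
  ultimately have "D < 1 / (36 * real m) * q\<^sup>2"
    by (simp add: D_def)
  then have D_less: "36 * real m * D < q\<^sup>2"
    using assms(4) by (simp add: field_simps)
  have q3: "q ^ 3 = (real n)\<^sup>2"
    using assms(3) by (simp add: q_def powr_power)
  have q1: "q \<ge> 1"
    using assms(3) by (simp add: q_def ge_one_powr_ge_zero)
  have D0: "D \<ge> 0" by (simp add: D_def)
  \<comment> \<open>From 6 on, \<open>x - 3\<close> is at least \<open>x / 2\<close>.\<close>
  have quad: "(real x)\<^sup>2 \<le> 2 * real (x * (x - 3))" if "x \<ge> 6" for x :: nat
  proof -
    have "real x * real x \<le> real x * (2 * (real x - 3))"
      using that by (intro mult_left_mono) auto
    then show ?thesis
      using that by (simp add: power2_eq_square of_nat_diff)
  qed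
  \<comment> \<open>Excluding the difference 0 is no restriction, so this is the plain pigeonhole
    step on all of \<open>A\<close>.\<close>
  obtain t where t: "t > 0"
    and t_pop: "n * (n - 3) \<le> 2 * card {x \<in> A. x + t \<in> A} * card (pos_diffs A)"
    using exists_popular_difference[of A A 0] assms(1-3) by auto
  define B where "B = {x \<in> A. x + t \<in> A}"
  define b where "b = card B"
  have "real (n * (n - 3)) \<le> 2 * real b * D"
    using t_pop unfolding b_def B_def D_def
    by (metis of_nat_le_iff of_nat_mult of_nat_numeral)
  then have bD: "q ^ 3 \<le> 4 * real b * D"
    using quad[OF assms(3)] q3 by simp
  \<comment> \<open>Otherwise \<open>4 * b * D\<close> would be below \<open>q * q^2 = n^2\<close>,
    against the first pigeonhole step.\<close>
  have b_ge: "9 * real m * q \<le> real b"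
  proof (rule ccontr)
    assume "\<not> ?thesis"
    then have "4 * real b * D \<le> 4 * (9 * real m * q) * D"
      using D0 by (intro mult_right_mono) linarith+
    also have "\<dots> = q * (36 * real m * D)" by simp
    also have "\<dots> < q * q\<^sup>2"
      using D_less q1 by (intro mult_strict_left_mono) auto
    also have "\<dots> = q ^ 3" by (simp add: power3_eq_cube power2_eq_square)
    finally show False using bD by simp
  qed
  have mq: "9 \<le> 9 * real m * q"
    using mult_mono[of 1 "real m" 1 q] assms(4) q1 by simp
  then have b6: "b \<ge> 6"
    using b_ge by linarith
  obtain s where s: "s > 0" "s \<noteq> t"
    and s_pop: "b * (b - 3) \<le> 2 * card {x \<in> B. x + s \<in> B} * card (pos_diffs A)"
    using exists_popular_difference[of A B t] assms(1) b6 by (auto simp: b_def B_def)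
  define M where "M = card {x \<in> B. x + s \<in> B}"
  have "real (b * (b - 3)) \<le> 2 * real M * D"
    using s_pop unfolding M_def D_def
    by (metis of_nat_le_iff of_nat_mult of_nat_numeral)
  then have MD: "(real b)\<^sup>2 \<le> 4 * real M * D"
    using quad[OF b6] by simp
  have "9 * m \<le> M"
  proof (rule ccontr)
    assume "\<not> ?thesis"
    then have "4 * real M * D \<le> 4 * (9 * real m) * D"
      using D0 by (intro mult_right_mono) auto
    also have "\<dots> < q\<^sup>2"
      using D_less by simp
    also have "\<dots> \<le> (9 * real m * q)\<^sup>2"
      using assms(4) q1 by (intro power_mono) (auto simp: mult_le_cancel_right1)
    also have "\<dots> \<le> (real b)\<^sup>2"
      using b_ge mq by (intro power_mono) linarith+
    finally show False using MD by simp
  qed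
  \<comment> \<open>A point of \<open>B\<close> whose shift by \<open>s\<close> is again in
    \<open>B\<close> is the base of a full parallelogram in \<open>A\<close>.\<close>
  moreover have "{x \<in> B. x + s \<in> B} = {x \<in> A. x + s \<in> A \<and> x + t \<in> A \<and> x + s + t \<in> A}"
    by (auto simp: B_def)
  ultimately obtain A' where A': "A' \<subseteq> A" "card A' = 4 * m"
      "2 * card (pos_diffs A') \<le> 9 * (m * (m - 1)) + 8"
    using few_differences_from_parallelograms[OF assms(1) s(1) t s(2), of m]
    by (auto simp: M_def)
  have "real (2 * card (pos_diffs A')) \<le> real (9 * (m * (m - 1)) + 8)"
    using A'(3) by (simp only: of_nat_le_iff)
  then have "real (card (pos_diffs A')) \<le> 9 * real m * (real m - 1) / 2 + 4"
    using assms(4) by (simp add: of_nat_diff)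
  moreover have "real (card (pos_diffs A')) \<ge> l"
    using local A' by (auto simp: local_diff_property_def)
  ultimately show False using l by simp
qed

theorem theorem1p5:
  fixes k :: nat
  assumes "k \<ge> 8" and "8 dvd k"
  shows "(\<lambda>n::nat. real (g_diff n k (9 * (real k)^2 / 32 - 9 * real k / 8 + 5)))
           \<in> \<Omega>(\<lambda>n. real n powr (4/3))"
proof -
  define l where "l = 9 * (real k)^2 / 32 - 9 * real k / 8 + 5"
  define m where "m = k div 4"
  have k: "k = 4 * m"
    using assms(2) by (auto simp: m_def elim!: dvdE)
  have m: "m \<ge> 1"
    using assms(1) k by simp
  \<comment> \<open>The threshold exceeds the parallelogram count
    \<open>9 * m * (m - 1) / 2 + 4\<close> by exactly 1.\<close>
  have l_eq: "l = 9 * real m * (real m - 1) / 2 + 5"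
    by (simp add: l_def k power2_eq_square field_simps)
  \<comment> \<open>The comparison below amounts to \<open>5 \<le> 7 * k^2 / 32 + 5 * k / 8\<close>;
    this bound on the square makes it linear.\<close>
  have "64 \<le> real k * real k"
    using mult_mono[of 8 "real k" 8 "real k"] assms(1) by simp
  then have l_le: "l \<le> real k * (real k - 1) / 2"
    using assms(1) by (simp add: l_def power2_eq_square field_simps)
  have "1 / (36 * real m) * real n powr (4/3) \<le> real (g_diff n k l)" if n: "n \<ge> 6" for n
  proof -
    let ?K = "{card (pos_diffs A) | A. finite A \<and> card A = n \<and> local_diff_property k l A}"
    have "?K \<noteq> {}"
      using exists_local_diff_property[OF l_le] assms(1) by auto
    then have "g_diff n k l \<in> ?K"
      unfolding g_diff_def by (rule Inf_nat_def1)
    then obtain A where "g_diff n k l = card (pos_diffs A)" "finite A" "card A = n"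
        "local_diff_property (4 * m) l A"
      using k by auto
    then show ?thesis
      using card_pos_diffs_lower_bound[of A n m l] n m l_eq by simp
  qed
  then have "eventually (\<lambda>n. 1 / (36 * real m) * norm (real n powr (4/3))
      \<le> norm (real (g_diff n k l))) at_top"
    by (intro eventually_at_top_linorderI[of 6]) simp
  then show ?thesis
    using m unfolding l_def by (intro landau_omega.bigI[of "1 / (36 * real m)"]) simp_all
qed

end
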